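(* Let $n \ge 2$ and $m \ge 1$ be integers, let $S_1, \ldots, S_m \subseteq \mathbb{Z}^n$ be L$^\natural$-convex sets, let $W = S_1 + \cdots + S_m$, and let $x \in \overline{W}$. Write $k = \lceil m/2 \rceil$, $\alpha(n,k) = \left(1 - \frac{1}{n}\right)\min(n,k)$ and $\beta(n,k) = \frac{1}{2}\sqrt{n \cdot \min(n,k)}$. Then: (1) there exists $z \in W$ with $\|x - z\|_\infty \le \alpha(n,k)$; if $x \in \overline{W} \cap \mathbb{Z}^n$, then there exists $z \in W$ with $\|x - z\|_\infty \le \lfloor \alpha(n,k) \rfloor = \min(n,k) - 1$; (2) there exists $z \in W$ with $\|x - z\|_2 \le \beta(n,k)$; if $x \in \overline{W} \cap \mathbb{Z}^n$, then there exists $z \in W$ with $\|x - z\|_\infty \le \lfloor \beta(n,k) \rfloor$; (3) there exists $z \in W$ with $\|x - z\|_\infty \le \min\{\alpha(n,k), \beta(n,k)\}$; if $x \in \overline{W} \cap \mathbb{Z}^n$, then there exists $z \in W$ with $\|x - z\|_\infty \le \min\{\lfloor \alpha(n,k) \rfloor, \lfloor \beta(n,k) \rfloor\}$.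
   Context: For $S \subseteq \mathbb{R}^n$, $\overline{S}$ denotes the convex hull of $S$; the Minkowski sum is $S_1 + \cdots + S_m = \{x^1 + \cdots + x^m \mid x^i \in S_i\}$. For vectors, $\lceil \cdot \rceil$ and $\lfloor \cdot \rfloor$ are applied componentwise. A nonempty set $S \subseteq \mathbb{Z}^n$ is L$^\natural$-convex if for all $x, y \in S$ both $\lceil (x+y)/2 \rceil$ and $\lfloor (x+y)/2 \rfloor$ belong to $S$. *)

theory Defs
  imports "HOL-Analysis.Analysis"
begin

definition int_lattice :: "(real ^ 'n) set" where
  "int_lattice = {x. \<forall>i. x $ i \<in> \<int>}"

definition vec_ceiling :: "real ^ 'n \<Rightarrow> real ^ 'n" where
  "vec_ceiling x = (\<chi> i. of_int \<lceil>x $ i\<rceil>)"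

definition vec_floor :: "real ^ 'n \<Rightarrow> real ^ 'n" where
  "vec_floor x = (\<chi> i. of_int \<lfloor>x $ i\<rfloor>)"

text \<open>Subsets of the integer lattice are represented inside \<^typ>\<open>real ^ 'n\<close>, so that convex
  hulls and norms apply to them without a coercion.\<close>

definition L_natural_convex :: "(real ^ 'n) set \<Rightarrow> bool" where
  "L_natural_convex S \<longleftrightarrow> S \<noteq> {} \<and> S \<subseteq> int_lattice \<and>
     (\<forall>x\<in>S. \<forall>y\<in>S. vec_ceiling ((1/2) *\<^sub>R (x + y)) \<in> S \<and> vec_floor ((1/2) *\<^sub>R (x + y)) \<in> S)"

definition alpha :: "nat \<Rightarrow> nat \<Rightarrow> real" where
  "alpha n k = (1 - 1 / real n) * real (min n k)"

definition beta :: "nat \<Rightarrow> nat \<Rightarrow> real" where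
  "beta n k = (1/2) * sqrt (real n * real (min n k))"

end

theory Submission
  imports Defs
begin

text \<open>If \<open>p\<close> is in the convex hull of an L-natural-convex set \<open>S\<close>, then \<open>S\<close> contains all the
  roundings \<open>\<lfloor>p + t\<rfloor>\<close> with a common shift \<open>t \<in> [0,1)\<close>, because \<open>S\<close> is cut out by integral bounds on
  coordinates and their differences; symmetrically for \<open>\<lceil>q - t\<rceil>\<close>. Averaging \<open>\<lfloor>p + t\<rfloor> + \<lceil>q - t\<rceil>\<close> over
  \<open>t\<close> shows that \<open>p + q\<close> is a convex combination of points of the sum of two such sets lying in one
  unit cube. Grouping the \<open>m\<close> summands into \<open>k\<close> pairs, the Shapley-Folkman theorem leaves at most
  \<open>min n k\<close> pairs that have to be rounded inside a unit cube. Each costs at most \<open>1 - 1/n\<close> in the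
  maximum norm, and \<open>n/4\<close> in the squared Euclidean norm if the vertices are chosen one after another
  against the error accumulated so far.\<close>

section \<open>Sets of integer vectors closed under discrete midpoints\<close>

text \<open>Taking midpoints with \<open>f\<close> again and again halves the offset
  \<open>g i - f i\<close>, rounding down. Eventually a nonnegative offset becomes 0 and a negative
  one sticks at -1.\<close>

lemma midpoint_closed_decrement:
  fixes D :: "('a::finite \<Rightarrow> int) set"
  assumes mid: "\<And>f g. f \<in> D \<Longrightarrow> g \<in> D \<Longrightarrow> (\<lambda>i. (f i + g i) div 2) \<in> D"
    and f: "f \<in> D" and g: "g \<in> D"
  shows "(\<lambda>i. f i - of_bool (g i < f i)) \<in> D"
proof -
  have halve: "(\<lambda>i. f i + (g i - f i) div 2 ^ k) \<in> D" for k
  proof (induction k)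
    case 0
    then show ?case using g by simp
  next
    case (Suc k)
    have "(f i + (f i + (g i - f i) div 2 ^ k)) div 2 = f i + (g i - f i) div 2 ^ Suc k" for i
    proof -
      have "(g i - f i) div 2 ^ Suc k = (g i - f i) div 2 ^ k div 2"
        by (simp add: power_Suc2 zdiv_zmult2_eq del: power_Suc)
      moreover have "(a + (a + d)) div 2 = a + d div 2" for a d :: int by presburger
      ultimately show ?thesis by (simp only:)
    qed
    then show ?case using mid[OF f Suc] by (simp only:)
  qed
  \<comment> \<open>One \<open>k\<close> for all coordinates: \<open>2 ^ k\<close> exceeds every
    offset, so each quotient has reached its limit 0 or -1.\<close>
  define k where "k = nat (\<Sum>i\<in>UNIV. \<bar>g i - f i\<bar>)"
  have "(g i - f i) div 2 ^ k = - of_bool (g i < f i)" for i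
  proof -
    have "\<bar>g i - f i\<bar> \<le> (\<Sum>i\<in>UNIV. \<bar>g i - f i\<bar>)"
      by (rule member_le_sum) auto
    also have "\<dots> = int k" by (simp add: k_def sum_nonneg)
    also have "\<dots> < 2 ^ k" by (rule of_nat_less_two_power)
    finally have less: "\<bar>g i - f i\<bar> < 2 ^ k" .
    show ?thesis
    proof (cases "g i < f i")
      case True
      have "(g i - f i) div 2 ^ k = -1"
        using less True by (intro int_div_pos_eq[where r = "g i - f i + 2 ^ k"]) auto
      then show ?thesis using True by simp
    next
      case False
      then show ?thesis using less by (simp add: div_pos_pos_trivial)
    qed
  qed
  then show ?thesis using halve[of k] by simp
qed

text \<open>Each decrement towards \<open>g\<close> lowers by one exactly the coordinates still
  above \<open>g\<close>; the \<open>max\<close> in \<open>step\<close> is the state after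
  \<open>k\<close> rounds.\<close>

lemma midpoint_closed_min:
  fixes D :: "('a::finite \<Rightarrow> int) set"
  assumes mid: "\<And>f g. f \<in> D \<Longrightarrow> g \<in> D \<Longrightarrow> (\<lambda>i. (f i + g i) div 2) \<in> D"
    and f: "f \<in> D" and g: "g \<in> D"
  shows "(\<lambda>i. min (f i) (g i)) \<in> D"
proof -
  have step: "(\<lambda>i. max (f i - int k) (min (f i) (g i))) \<in> D" for k
  proof (induction k)
    case 0
    have "max (f i - int 0) (min (f i) (g i)) = f i" for i by simp
    then show ?case using f by simp
  next
    case (Suc k)
    let ?h = "\<lambda>i. max (f i - int k) (min (f i) (g i))"
    have "?h i - of_bool (g i < ?h i) = max (f i - int (Suc k)) (min (f i) (g i))" for i
      by (auto simp: of_bool_def max_def min_def)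
    moreover have "(\<lambda>i. ?h i - of_bool (g i < ?h i)) \<in> D"
      using mid Suc g by (rule midpoint_closed_decrement)
    ultimately show ?case by (simp only:)
  qed
  define k where "k = nat (\<Sum>i\<in>UNIV. \<bar>g i - f i\<bar>)"
  have "max (f i - int k) (min (f i) (g i)) = min (f i) (g i)" for i
  proof -
    have "\<bar>g i - f i\<bar> \<le> (\<Sum>i\<in>UNIV. \<bar>g i - f i\<bar>)"
      by (rule member_le_sum) auto
    also have "\<dots> = int k" by (simp add: k_def sum_nonneg)
    finally show ?thesis by (auto simp: max_def min_def)
  qed
  then show ?thesis using step[of k] by simp
qed

text \<open>Dual to the minimum by negation. Negation turns rounding down into rounding up, and
  shifting one argument by 1 turns it back.\<close>

lemma midpoint_closed_max:
  fixes D :: "('a::finite \<Rightarrow> int) set"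
  assumes mid: "\<And>f g. f \<in> D \<Longrightarrow> g \<in> D \<Longrightarrow> (\<lambda>i. (f i + g i) div 2) \<in> D"
    and shift: "\<And>f c. f \<in> D \<Longrightarrow> (\<lambda>i. f i + c) \<in> D"
    and f: "f \<in> D" and g: "g \<in> D"
  shows "(\<lambda>i. max (f i) (g i)) \<in> D"
proof -
  let ?E = "{f. (\<lambda>i. - f i) \<in> D}"
  have "(\<lambda>i. min (- f i) (- g i)) \<in> ?E"
  proof (rule midpoint_closed_min)
    fix p q assume "p \<in> ?E" "q \<in> ?E"
    then have "(\<lambda>i. (- p i + (- q i + 1)) div 2) \<in> D"
      using mid shift by fastforce
    moreover have "(- p i + (- q i + 1)) div 2 = - ((p i + q i) div 2)" for i
      by presburger
    ultimately show "(\<lambda>i. (p i + q i) div 2) \<in> ?E" by simp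
  qed (use f g in auto)
  moreover have "- min (- f i) (- g i) = max (f i) (g i)" for i by simp
  ultimately show ?thesis by simp
qed

text \<open>A set of integer vectors closed under shifts, minima and maxima is cut out by its
  constraints on pairwise differences: the maximum over \<open>b\<close> of suitable witnesses lies above
  \<open>r\<close> and touches it at \<open>a\<close>, and the minimum of these over \<open>a\<close> is \<open>r\<close>.\<close>

lemma midpoint_closed_memI:
  fixes D :: "('a::finite \<Rightarrow> int) set"
  assumes mid: "\<And>f g. f \<in> D \<Longrightarrow> g \<in> D \<Longrightarrow> (\<lambda>i. (f i + g i) div 2) \<in> D"
    and shift: "\<And>f c. f \<in> D \<Longrightarrow> (\<lambda>i. f i + c) \<in> D"
    and diff: "\<And>a b. \<exists>f\<in>D. r b - r a \<le> f b - f a"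
  shows "r \<in> D"
proof -
  have touch: "\<exists>h\<in>D. h a = r a \<and> r b \<le> h b" for a b
  proof -
    obtain f where "f \<in> D" "r b - r a \<le> f b - f a" using diff by blast
    then show ?thesis by (intro bexI[of _ "\<lambda>i. f i + (r a - f a)"] shift) auto
  qed
  have above: "\<exists>h\<in>D. h a = r a \<and> (\<forall>b\<in>B. r b \<le> h b)" for a and B :: "'a set"
  proof (induction B rule: finite_induct[OF finite])
    case 1
    then show ?case using touch by blast
  next
    case (2 b B)
    then obtain h h' where "h \<in> D" "h a = r a" "\<forall>b\<in>B. r b \<le> h b" "h' \<in> D" "h' a = r a" "r b \<le> h' b"
      using touch by blast
    then show ?case
      by (intro bexI[of _ "\<lambda>i. max (h i) (h' i)"] midpoint_closed_max mid shift) (auto simp: le_max_iff_disj)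
  qed
  have "\<exists>h\<in>D. (\<forall>b. r b \<le> h b) \<and> (\<forall>a\<in>A. h a = r a)" for A :: "'a set"
  proof (induction A rule: finite_induct[OF finite])
    case 1
    then show ?case using above[of undefined UNIV] by blast
  next
    case (2 a A)
    then obtain h h' where "h \<in> D" "\<forall>b. r b \<le> h b" "\<forall>a\<in>A. h a = r a"
        "h' \<in> D" "h' a = r a" "\<forall>b. r b \<le> h' b"
      using above[of a UNIV] by blast
    then show ?case
      by (intro bexI[of _ "\<lambda>i. min (h i) (h' i)"] midpoint_closed_min mid)
         (auto simp: min_def intro: antisym)
  qed
  from this[of UNIV] obtain h where "h \<in> D" "\<And>a. h a = r a" by blast
  then show ?thesis by (metis ext)
qed

section \<open>Rounding in L-natural-convex sets\<close>

text \<open>Otherwise \<open>l\<close> would map \<open>S\<close>, and hence its hull, into the open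
  half-line below \<open>l p\<close>. Later, points of \<open>S\<close> that beat a hull point in a
  prescribed direction are found this way.\<close>

lemma convex_hull_linear_ge:
  fixes l :: "'a::real_vector \<Rightarrow> real"
  assumes "linear l" and "p \<in> convex hull S"
  shows "\<exists>s\<in>S. l p \<le> l s"
proof (rule ccontr)
  assume "\<not> (\<exists>s\<in>S. l p \<le> l s)"
  then have "l ` S \<subseteq> {..<l p}" by (auto simp: not_le)
  then have "convex hull (l ` S) \<subseteq> {..<l p}" by (intro hull_minimal) auto
  moreover have "l p \<in> convex hull (l ` S)"
    using assms by (rule in_convex_hull_linear_image)
  ultimately show False by auto
qed

text \<open>The homogenized set, with the extra coordinate \<open>None\<close>, is closed under integer shifts;
  this lets the rounded-up midpoints be expressed by rounded-down ones.\<close>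

lemma L_natural_convex_floor_shift:
  fixes S :: "(real ^ 'n) set"
  assumes S: "L_natural_convex S" and p: "p \<in> convex hull S" and t: "0 \<le> t" "t < 1"
  shows "(\<chi> i. of_int \<lfloor>p $ i + t\<rfloor>) \<in> S"
proof -
  \<comment> \<open>Value 0 at \<open>None\<close> makes a coordinate bound a special case of a
    bound on a difference.\<close>
  define ext :: "real ^ 'n \<Rightarrow> 'n option \<Rightarrow> real" where
    "ext q a = (case a of None \<Rightarrow> 0 | Some i \<Rightarrow> q $ i)" for q a
  define dehom :: "('n option \<Rightarrow> int) \<Rightarrow> real ^ 'n" where
    "dehom f = (\<chi> i. of_int (f (Some i) - f None))" for f
  define D where "D = {f. dehom f \<in> S}"
  define r where "r a = \<lfloor>ext p a + t\<rfloor>" for a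
  have "r \<in> D"
  proof (rule midpoint_closed_memI)
    fix f g assume fg: "f \<in> D" "g \<in> D"
    let ?h = "\<lambda>a. (f a + g a) div 2"
    have half: "((1 / 2) *\<^sub>R (dehom f + dehom g)) $ i =
        of_int (f (Some i) - f None + (g (Some i) - g None)) / 2" for i
      by (simp add: dehom_def)
    have fl: "\<lfloor>(of_int z :: real) / 2\<rfloor> = z div 2" for z
      using floor_divide_of_int_eq[of z 2] by simp
    have ce: "\<lceil>(of_int z :: real) / 2\<rceil> = (z + 1) div 2" for z
    proof -
      have "\<lceil>(of_int z :: real) / 2\<rceil> = - (- z div 2)"
        using ceiling_divide_eq_div[of z 2] by simp
      then show ?thesis by presburger
    qed
    show "?h \<in> D"
    \<comment> \<open>Subtracting the rounded \<open>None\<close> entry leaves a floor of the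
      dehomogenized midpoint when the \<open>None\<close> entries have an even sum, and a ceiling
      when it is odd.\<close>
    proof (cases "even (f None + g None)")
      case True
      then have "?h (Some i) - ?h None = (f (Some i) - f None + (g (Some i) - g None)) div 2" for i
        by presburger
      then have "dehom ?h = vec_floor ((1/2) *\<^sub>R (dehom f + dehom g))"
        unfolding vec_floor_def half fl by (simp only: dehom_def)
      then show ?thesis using S fg by (auto simp: L_natural_convex_def D_def)
    next
      case False
      then obtain e where e: "f None + g None = 2 * e + 1" by (elim oddE)
      have "?h (Some i) - ?h None = (f (Some i) - f None + (g (Some i) - g None) + 1) div 2" for i
      proof -
        have "f (Some i) - f None + (g (Some i) - g None) + 1 = f (Some i) + g (Some i) - 2 * e"
          using e by simp
        moreover have "(z - 2 * e) div 2 = z div 2 - e" for z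
          using div_mult_self1[of 2 z "- e"] by simp
        moreover have "(2 * e + 1) div 2 = e" by simp
        ultimately show ?thesis unfolding e by (simp only:)
      qed
      then have "dehom ?h = vec_ceiling ((1/2) *\<^sub>R (dehom f + dehom g))"
        unfolding vec_ceiling_def half ce by (simp only: dehom_def)
      then show ?thesis using S fg by (auto simp: L_natural_convex_def D_def)
    qed
  next
    fix f c assume "f \<in> D"
    then show "(\<lambda>a. f a + c) \<in> D" by (simp add: D_def dehom_def)
  next
    fix a b
    have "linear (\<lambda>q. ext q b - ext q a)"
      by (rule linearI) (auto simp: ext_def algebra_simps split: option.splits)
    then obtain s where s: "s \<in> S" "ext p b - ext p a \<le> ext s b - ext s a"
      using convex_hull_linear_ge[OF _ p] by blast
    define f where "f = (\<lambda>a. \<lfloor>ext s a\<rfloor>)"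
    have "s \<in> int_lattice" using s(1) S by (auto simp: L_natural_convex_def)
    then have int: "of_int (f a) = ext s a" for a
      by (simp add: f_def ext_def int_lattice_def of_int_floor_cancel split: option.split)
    have "dehom f = s"
      unfolding dehom_def of_int_diff int by (simp add: ext_def)
    then have "f \<in> D" using s by (simp add: D_def)
    \<comment> \<open>Flooring with a common shift raises a difference by less than 1, so between
      integers the inequality survives without the 1.\<close>
    moreover have "real_of_int (r b - r a) < of_int (f b - f a) + 1"
      using s(2) unfolding of_int_diff int r_def by linarith
    then have "r b - r a \<le> f b - f a" by linarith
    ultimately show "\<exists>f\<in>D. r b - r a \<le> f b - f a" by blast
  qed
  moreover have "dehom r = (\<chi> i. of_int \<lfloor>p $ i + t\<rfloor>)"
  proof -
    \<comment> \<open>Hence \<open>r None = 0\<close>, and dehomogenizing subtracts nothing.\<close>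
    have "\<lfloor>t\<rfloor> = 0" using t by linarith
    then show ?thesis by (simp add: dehom_def r_def ext_def)
  qed
  ultimately show ?thesis by (simp add: D_def)
qed

lemma L_natural_convex_uminus:
  assumes "L_natural_convex S"
  shows "L_natural_convex (uminus ` S)"
proof -
  have half: "(1/2) *\<^sub>R (- x + - y) = - ((1/2) *\<^sub>R (x + y))" for x y :: "real ^ 'a"
    by (simp add: algebra_simps)
  have "vec_ceiling (- v) = - vec_floor v" and "vec_floor (- v) = - vec_ceiling v" for v :: "real ^ 'a"
    by (simp_all add: vec_ceiling_def vec_floor_def vec_eq_iff ceiling_def)
  then show ?thesis
    using assms unfolding L_natural_convex_def ball_simps half by (auto simp: int_lattice_def)
qed

lemma L_natural_convex_ceiling_shift:
  fixes S :: "(real ^ 'n) set"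
  assumes S: "L_natural_convex S" and q: "q \<in> convex hull S" and t: "0 \<le> t" "t < 1"
  shows "(\<chi> i. of_int \<lceil>q $ i - t\<rceil>) \<in> S"
proof -
  have "- q \<in> convex hull (uminus ` S)"
    using q by (rule in_convex_hull_linear_image[rotated]) (simp add: linear_iff)
  with L_natural_convex_uminus[OF S] have "(\<chi> i. of_int \<lfloor>(- q) $ i + t\<rfloor>) \<in> uminus ` S"
    using t by (rule L_natural_convex_floor_shift)
  then have "- (\<chi> i. of_int \<lfloor>(- q) $ i + t\<rfloor>) \<in> S" by auto
  moreover have "- (\<chi> i. real_of_int \<lfloor>(- q) $ i + t\<rfloor>) = (\<chi> i. of_int \<lceil>q $ i - t\<rceil>)"
    by (simp add: vec_eq_iff ceiling_def)
  ultimately show ?thesis by simp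
qed

text \<open>The floor equals \<open>\<lfloor>c\<rfloor>\<close> until \<open>t\<close> reaches
  \<open>1 - frac c\<close> and is one larger afterwards, on a stretch of length
  \<open>frac c\<close>.\<close>

lemma has_integral_floor_shift:
  "((\<lambda>t. of_int \<lfloor>c + t\<rfloor>) has_integral c) {0..1::real}"
proof -
  define m where "m = real_of_int \<lfloor>c\<rfloor>"
  define b where "b = 1 - frac c"
  have b: "0 \<le> b" "b \<le> 1" "c = m + (1 - b)"
    using frac_lt_1[of c] frac_ge_0[of c] by (auto simp: b_def m_def frac_def)
  have "((\<lambda>t. of_int \<lfloor>c + t\<rfloor>) has_integral b * m) {0..b}"
  proof (rule has_integral_spike_finite[of "{b}"])
    show "((\<lambda>t. m) has_integral b * m) {0..b}"
      using has_integral_const_real[of m 0 b] b by simp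
    fix t assume "t \<in> {0..b} - {b}"
    then have "\<lfloor>c + t\<rfloor> = \<lfloor>c\<rfloor>" using b unfolding m_def by (intro floor_unique) auto
    then show "of_int \<lfloor>c + t\<rfloor> = m" by (simp add: m_def)
  qed simp
  moreover have "((\<lambda>t. of_int \<lfloor>c + t\<rfloor>) has_integral (1 - b) * (m + 1)) {b..1}"
  proof (rule has_integral_spike_finite[of "{1}"])
    show "((\<lambda>t. m + 1) has_integral (1 - b) * (m + 1)) {b..1}"
      using has_integral_const_real[of "m + 1" b 1] b by simp
    fix t assume "t \<in> {b..1} - {1}"
    then have "\<lfloor>c + t\<rfloor> = \<lfloor>c\<rfloor> + 1" using b unfolding m_def by (intro floor_unique) auto
    then show "of_int \<lfloor>c + t\<rfloor> = m + 1" by (simp add: m_def)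
  qed simp
  ultimately have "((\<lambda>t. of_int \<lfloor>c + t\<rfloor>) has_integral b * m + (1 - b) * (m + 1)) {0..1}"
    using b by (intro has_integral_combine) auto
  moreover have "b * m + (1 - b) * (m + 1) = c" using b by (simp add: algebra_simps)
  ultimately show ?thesis by simp
qed

text \<open>Only the vertices of the cube, not the solid cube: this keeps the sets of candidates
  finite.\<close>

definition unit_cube :: "real ^ 'n \<Rightarrow> (real ^ 'n) set" where
  "unit_cube b = {z. \<forall>i. z $ i = b $ i \<or> z $ i = b $ i + 1}"

lemma finite_unit_cube: "finite (unit_cube (b :: real ^ 'n))"
proof (rule finite_subset)
  show "unit_cube b \<subseteq> range (\<lambda>B::'n set. \<chi> i. if i \<in> B then b $ i + 1 else b $ i)"
  proof
    fix z assume "z \<in> unit_cube b"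
    then have "z = (\<chi> i. if i \<in> {i. z $ i = b $ i + 1} then b $ i + 1 else b $ i)"
      by (auto simp: unit_cube_def vec_eq_iff)
    then show "z \<in> range (\<lambda>B::'n set. \<chi> i. if i \<in> B then b $ i + 1 else b $ i)" by blast
  qed
qed simp

text \<open>The points \<open>\<lfloor>p + t\<rfloor> + \<lceil>q - t\<rceil>\<close> for \<open>0 \<le> t < 1\<close> differ from \<open>p + q\<close> by less than one in each
  coordinate, and their average over \<open>t\<close> is \<open>p + q\<close>.\<close>

lemma L_natural_convex_sum_local_hull:
  fixes S1 S2 :: "(real ^ 'n) set"
  assumes S1: "L_natural_convex S1" and S2: "L_natural_convex S2"
    and x: "x \<in> convex hull (S1 + S2)"
  shows "x \<in> convex hull ((S1 + S2) \<inter> unit_cube (vec_floor x))"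
proof (rule ccontr)
  let ?A = "(S1 + S2) \<inter> unit_cube (vec_floor x)"
  assume "x \<notin> convex hull ?A"
  moreover have "closed (convex hull ?A)"
    by (simp add: finite_unit_cube finite_imp_compact compact_convex_hull compact_imp_closed)
  ultimately obtain v c where vc: "v \<bullet> x < c" "\<And>z. z \<in> convex hull ?A \<Longrightarrow> c < v \<bullet> z"
    using separating_hyperplane_closed_point[of "convex hull ?A" x] by auto
  obtain p q where pq: "x = p + q" "p \<in> convex hull S1" "q \<in> convex hull S2"
    using x unfolding convex_hull_set_plus by (rule set_plus_elim)
  define z :: "real \<Rightarrow> real ^ 'n" where "z t = (\<chi> i. of_int \<lfloor>p $ i + t\<rfloor> + of_int \<lceil>q $ i - t\<rceil>)" for t
  have mem: "z t \<in> ?A" if t: "0 \<le> t" "t < 1" for t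
  proof -
    have "z t = (\<chi> i. of_int \<lfloor>p $ i + t\<rfloor>) + (\<chi> i. of_int \<lceil>q $ i - t\<rceil>)"
      by (simp add: z_def vec_eq_iff)
    then have "z t \<in> S1 + S2"
      using L_natural_convex_floor_shift[OF S1 pq(2) t] L_natural_convex_ceiling_shift[OF S2 pq(3) t]
      by (simp add: set_plus_intro)
    moreover have "\<lfloor>p $ i + t\<rfloor> + \<lceil>q $ i - t\<rceil> = \<lfloor>x $ i\<rfloor> \<or> \<lfloor>p $ i + t\<rfloor> + \<lceil>q $ i - t\<rceil> = \<lfloor>x $ i\<rfloor> + 1" for i
      unfolding pq(1) vector_add_component by linarith
    then have "real_of_int (\<lfloor>p $ i + t\<rfloor> + \<lceil>q $ i - t\<rceil>) = of_int \<lfloor>x $ i\<rfloor> \<or>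
        real_of_int (\<lfloor>p $ i + t\<rfloor> + \<lceil>q $ i - t\<rceil>) = of_int \<lfloor>x $ i\<rfloor> + 1" for i
      by (metis of_int_add of_int_1)
    then have "z t \<in> unit_cube (vec_floor x)"
      by (simp add: unit_cube_def z_def vec_floor_def)
    ultimately show ?thesis by blast
  qed
  have int_z: "((\<lambda>t. v \<bullet> z t) has_integral v \<bullet> x) {0..1}"
    unfolding inner_vec_def inner_real_def z_def vec_lambda_beta
  proof (intro has_integral_sum has_integral_mult_right finite)
    fix i
    \<comment> \<open>The ceiling is rewritten as
      \<open>\<lceil>q - t\<rceil> = - \<lfloor>- q + t\<rfloor>\<close>, so both terms are
      integrals of shifted floors.\<close>
    have "((\<lambda>t. of_int \<lfloor>p $ i + t\<rfloor> - of_int \<lfloor>- q $ i + t\<rfloor>) has_integral p $ i - - q $ i) {0..1::real}"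
      by (intro has_integral_diff has_integral_floor_shift)
    then show "((\<lambda>t. of_int \<lfloor>p $ i + t\<rfloor> + of_int \<lceil>q $ i - t\<rceil>) has_integral x $ i) {0..1::real}"
      by (simp add: ceiling_def pq(1))
  qed
  have int_c: "((\<lambda>t. c) has_integral c) {0..1::real}"
    using has_integral_const_real[of c 0 1] by simp
  have "c \<le> v \<bullet> z t" if "t \<in> {0..1}" for t
  proof (cases "t = 1")
    case True
    \<comment> \<open>The endpoint lies outside the range of \<open>mem\<close>, but a shift by 1
      cancels between floor and ceiling.\<close>
    have "z 1 = z 0" by (simp add: z_def vec_eq_iff)
    then show ?thesis using True vc(2) mem[of 0] by (simp add: hull_inc less_imp_le)
  next
    case False
    then show ?thesis using that vc(2) mem[of t] by (simp add: hull_inc less_imp_le)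
  qed
  then have "c \<le> v \<bullet> x" by (rule has_integral_le[OF int_c int_z])
  then show False using vc(1) by simp
qed

section \<open>The Shapley-Folkman theorem\<close>

lemma convex_combination_slide:
  fixes y :: "'a::real_vector"
  assumes fin: "finite B" and w: "\<And>b. b \<in> B \<Longrightarrow> 0 < w b" "sum w B = 1" "(\<Sum>b\<in>B. w b *\<^sub>R b) = y"
    and ab: "a \<in> B" "b \<in> B" "a \<noteq> b" and c: "0 < c"
  shows "\<exists>\<tau>>0. (\<forall>t\<in>{0..\<tau>}. y + (t * c) *\<^sub>R (a - b) \<in> convex hull B) \<and>
           (\<exists>B'\<subset>B. y + (\<tau> * c) *\<^sub>R (a - b) \<in> convex hull B')"
proof -
  define w' where "w' s x = w x + (if x = a then s else 0) - (if x = b then s else 0)" for s x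
  have sum_w': "sum (w' s) B = 1" and comb_w': "(\<Sum>x\<in>B. w' s x *\<^sub>R x) = y + s *\<^sub>R (a - b)" for s
  proof -
    show "sum (w' s) B = 1"
      using fin ab w by (simp add: w'_def sum.distrib sum_subtractf)
    have "(if x = d then s else 0) *\<^sub>R x = (if x = d then s *\<^sub>R d else 0)" for x d :: 'a
      by simp
    then show "(\<Sum>x\<in>B. w' s x *\<^sub>R x) = y + s *\<^sub>R (a - b)"
      using fin ab w by (simp add: w'_def scaleR_add_left scaleR_diff_left sum.distrib sum_subtractf scaleR_diff_right)
  qed
  have w'_nonneg: "0 \<le> w' s x" if "0 \<le> s" "s \<le> w b" "x \<in> B" for s x
    using that w(1)[OF that(3)] ab by (auto simp: w'_def)
  have hull: "y + s *\<^sub>R (a - b) \<in> convex hull B" if "0 \<le> s" "s \<le> w b" for s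
    unfolding convex_hull_finite[OF fin] using w'_nonneg[OF that] sum_w'[of s] comb_w'[of s] by blast
  have "w' (w b) b = 0" using ab by (simp add: w'_def)
  then have "sum (w' (w b)) (B - {b}) = 1" "(\<Sum>x\<in>B - {b}. w' (w b) x *\<^sub>R x) = y + w b *\<^sub>R (a - b)"
    using sum_w'[of "w b"] comb_w'[of "w b"] fin ab by (simp_all add: sum_diff1)
  moreover have "\<forall>x\<in>B - {b}. 0 \<le> w' (w b) x" using w'_nonneg w(1) ab by (simp add: less_imp_le)
  ultimately have face: "y + w b *\<^sub>R (a - b) \<in> convex hull (B - {b})"
    unfolding convex_hull_finite[OF finite_Diff[OF fin]] by blast
  show ?thesis
  proof (intro exI[of _ "w b / c"] conjI ballI)
    show "0 < w b / c" using w(1)[OF ab(2)] c by simp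
    show "y + (t * c) *\<^sub>R (a - b) \<in> convex hull B" if "t \<in> {0..w b / c}" for t
      using that c by (intro hull) (auto simp: field_simps)
    show "\<exists>B'\<subset>B. y + (w b / c * c) *\<^sub>R (a - b) \<in> convex hull B'"
      using face c ab by (intro exI[of _ "B - {b}"]) auto
  qed
qed

text \<open>Minimality of \<open>B\<close> makes all weights positive, and
  \<open>y \<notin> B\<close> provides two distinct points. For negative \<open>c\<close> their
  roles are exchanged.\<close>

lemma convex_hull_slide_direction:
  fixes y :: "'a::real_vector"
  assumes fin: "finite B" and y: "y \<in> convex hull B" "y \<notin> B"
    and minimal: "\<And>B'. B' \<subset> B \<Longrightarrow> y \<notin> convex hull B'"
  shows "\<exists>d. \<forall>c. c \<noteq> 0 \<longrightarrow> (\<exists>\<tau>>0. (\<forall>t\<in>{0..\<tau>}. y + (t * c) *\<^sub>R d \<in> convex hull B) \<and>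
           (\<exists>B'\<subset>B. y + (\<tau> * c) *\<^sub>R d \<in> convex hull B'))"
proof -
  obtain w where w0: "\<forall>b\<in>B. 0 \<le> w b" and w: "sum w B = 1" "(\<Sum>b\<in>B. w b *\<^sub>R b) = y"
    using y(1) unfolding convex_hull_finite[OF fin] by blast
  have pos: "0 < w b" if "b \<in> B" for b
  proof (rule ccontr)
    assume "\<not> 0 < w b"
    then have "w b = 0" using w0 that by force
    then have "sum w (B - {b}) = 1" "(\<Sum>x\<in>B - {b}. w x *\<^sub>R x) = y"
      using w fin that by (simp_all add: sum_diff1)
    then have "y \<in> convex hull (B - {b})"
      unfolding convex_hull_finite[OF finite_Diff[OF fin]] using w0 by blast
    then show False using minimal[of "B - {b}"] that by blast
  qed
  have "B \<noteq> {}" using w(1) by auto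
  then obtain a where a: "a \<in> B" by blast
  have "B \<noteq> {a}" using y by auto
  then obtain b where b: "b \<in> B" "a \<noteq> b" using a by blast
  have "\<exists>\<tau>>0. (\<forall>t\<in>{0..\<tau>}. y + (t * c) *\<^sub>R (a - b) \<in> convex hull B) \<and>
           (\<exists>B'\<subset>B. y + (\<tau> * c) *\<^sub>R (a - b) \<in> convex hull B')" if "c \<noteq> 0" for c
  proof (cases "0 < c")
    case True
    show ?thesis by (rule convex_combination_slide[OF fin pos w a b True])
  next
    case False
    then have "0 < - c" using that by simp
    moreover have "(t * - c) *\<^sub>R (b - a) = (t * c) *\<^sub>R (a - b)" for t
      by (simp add: algebra_simps)
    ultimately show ?thesis
      using convex_combination_slide[OF fin pos w b(1) a b(2)[symmetric], of "- c"] by simp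
  qed
  then show ?thesis by blast
qed

text \<open>Stated for families since directions of different summands may coincide; then
  coefficients 1 and -1 already give a relation.\<close>

lemma linear_relation_indexed:
  fixes d :: "'i \<Rightarrow> 'a::euclidean_space"
  assumes "finite F" and "DIM('a) < card F"
  shows "\<exists>c. (\<exists>j\<in>F. c j \<noteq> 0) \<and> (\<Sum>j\<in>F. c j *\<^sub>R d j) = 0"
proof (cases "inj_on d F")
  case True
  then have "dependent (d ` F)"
    using assms by (intro dependent_biggerset) (simp add: card_image)
  then obtain u where "\<exists>v\<in>d ` F. u v \<noteq> 0" "(\<Sum>v\<in>d ` F. u v *\<^sub>R v) = 0"
    using assms by (auto simp: dependent_finite)
  then show ?thesis
    using True by (intro exI[of _ "u \<circ> d"]) (auto simp: sum.reindex)
next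
  case False
  then obtain i j where ij: "i \<in> F" "j \<in> F" "i \<noteq> j" "d i = d j" by (auto simp: inj_on_def)
  let ?c = "\<lambda>l. (if l = i then 1 else 0) - (if l = j then 1 else 0 :: real)"
  have "(if l = k then 1 else 0) *\<^sub>R d l = (if l = k then d k else 0)" for l k by simp
  then have "(\<Sum>l\<in>F. ?c l *\<^sub>R d l) = 0"
    using ij assms by (simp add: scaleR_diff_left sum_subtractf)
  then show ?thesis using ij by (intro exI[of _ ?c]) auto
qed

text \<open>If more than \<open>DIM('a)\<close> summands are not vertices, then a linear relation between directions
  in which they can be moved lets all of them slide, keeping the sum, until one of them reaches
  a proper face.\<close>

lemma Shapley_Folkman_reduction:
  fixes y :: "'i \<Rightarrow> 'a::euclidean_space"
  assumes J: "finite J" and fin: "\<And>j. j \<in> J \<Longrightarrow> finite (B j)"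
    and y: "\<And>j. j \<in> J \<Longrightarrow> y j \<in> convex hull (B j)"
    and many: "DIM('a) < card {j\<in>J. y j \<notin> B j}"
  shows "\<exists>y' i B'. i \<in> J \<and> B' \<subset> B i \<and> y' i \<in> convex hull B' \<and>
           (\<forall>j\<in>J. y' j \<in> convex hull (B j)) \<and> sum y' J = sum y J"
proof (cases "\<exists>i\<in>J. \<exists>B'\<subset>B i. y i \<in> convex hull B'")
  case True
  then show ?thesis using y by blast
next
  case False
  define F where "F = {j\<in>J. y j \<notin> B j}"
  have F: "finite F" "F \<subseteq> J" using J by (auto simp: F_def)
  \<comment> \<open>In this case each \<open>B j\<close> is minimal for \<open>y j\<close>, as the
    sliding lemma requires.\<close>
  have "\<exists>d. \<forall>c. c \<noteq> 0 \<longrightarrow> (\<exists>\<tau>>0. (\<forall>t\<in>{0..\<tau>}. y j + (t * c) *\<^sub>R d \<in> convex hull (B j)) \<and>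
           (\<exists>B'\<subset>B j. y j + (\<tau> * c) *\<^sub>R d \<in> convex hull B'))" if "j \<in> F" for j
    using that False fin y by (intro convex_hull_slide_direction) (auto simp: F_def)
  then obtain d where d: "\<And>j c. j \<in> F \<Longrightarrow> c \<noteq> 0 \<Longrightarrow>
      \<exists>\<tau>>0. (\<forall>t\<in>{0..\<tau>}. y j + (t * c) *\<^sub>R d j \<in> convex hull (B j)) \<and>
           (\<exists>B'\<subset>B j. y j + (\<tau> * c) *\<^sub>R d j \<in> convex hull B')" by metis
  obtain c where c: "\<exists>j\<in>F. c j \<noteq> 0" "(\<Sum>j\<in>F. c j *\<^sub>R d j) = 0"
    using linear_relation_indexed[OF F(1)] many unfolding F_def by blast
  define G where "G = {j\<in>F. c j \<noteq> 0}"
  have G: "finite G" "G \<noteq> {}" "G \<subseteq> F" using F c(1) by (auto simp: G_def)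
  have "\<forall>j\<in>G. \<exists>\<tau>>0. (\<forall>t\<in>{0..\<tau>}. y j + (t * c j) *\<^sub>R d j \<in> convex hull (B j)) \<and>
      (\<exists>B'\<subset>B j. y j + (\<tau> * c j) *\<^sub>R d j \<in> convex hull B')"
    using d by (simp add: G_def)
  then obtain \<tau> where \<tau>: "\<And>j. j \<in> G \<Longrightarrow> 0 < \<tau> j \<and>
      (\<forall>t\<in>{0..\<tau> j}. y j + (t * c j) *\<^sub>R d j \<in> convex hull (B j)) \<and>
      (\<exists>B'\<subset>B j. y j + (\<tau> j * c j) *\<^sub>R d j \<in> convex hull B')"
    by metis
  \<comment> \<open>The first summand to reach a proper face; up to that time all others are still
    in their hulls.\<close>
  obtain i where i: "i \<in> G" "\<And>j. j \<in> G \<Longrightarrow> \<tau> i \<le> \<tau> j"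
    using arg_min_if_finite[OF G(1,2), of \<tau>] by (metis not_le)
  define y' where "y' j = y j + (if j \<in> G then (\<tau> i * c j) *\<^sub>R d j else 0)" for j
  obtain B' where "B' \<subset> B i" "y' i \<in> convex hull B'"
    using \<tau>[OF i(1)] i(1) by (auto simp: y'_def)
  moreover have "y' j \<in> convex hull (B j)" if "j \<in> J" for j
  proof (cases "j \<in> G")
    case True
    have "\<tau> i \<in> {0..\<tau> j}" using \<tau>[OF i(1)] i(2)[OF True] by auto
    then show ?thesis using \<tau>[OF True] True by (auto simp: y'_def)
  next
    case False
    then show ?thesis using y that by (simp add: y'_def)
  qed
  moreover have "sum y' J = sum y J"
  proof -
    have "(\<Sum>j\<in>J. if j \<in> G then (\<tau> i * c j) *\<^sub>R d j else 0) = (\<Sum>j\<in>G. (\<tau> i * c j) *\<^sub>R d j)"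
      using J F G by (intro sum.mono_neutral_cong_right) auto
    also have "\<dots> = (\<Sum>j\<in>F. (\<tau> i * c j) *\<^sub>R d j)"
      using F G by (intro sum.mono_neutral_left) (auto simp: G_def)
    also have "\<dots> = \<tau> i *\<^sub>R (\<Sum>j\<in>F. c j *\<^sub>R d j)"
      by (simp add: scaleR_sum_right)
    finally show ?thesis using c by (simp add: y'_def sum.distrib)
  qed
  ultimately show ?thesis using i G F by blast
qed

text \<open>Induction on the total number of generators: as long as too many summands are not
  vertices, a reduction step shrinks one generating set.\<close>

theorem Shapley_Folkman:
  fixes y :: "'i \<Rightarrow> 'a::euclidean_space"
  assumes J: "finite J" and "\<And>j. j \<in> J \<Longrightarrow> finite (B j)"
    and "\<And>j. j \<in> J \<Longrightarrow> y j \<in> convex hull (B j)"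
  shows "\<exists>y'. (\<forall>j\<in>J. y' j \<in> convex hull (B j)) \<and> sum y' J = sum y J \<and>
           card {j\<in>J. y' j \<notin> B j} \<le> DIM('a)"
  using assms(2,3)
proof (induction "\<Sum>j\<in>J. card (B j)" arbitrary: B y rule: less_induct)
  case less
  show ?case
  proof (cases "DIM('a) < card {j\<in>J. y j \<notin> B j}")
    case False
    then show ?thesis by (intro exI[of _ y] conjI ballI less.prems(2)) simp_all
  next
    case True
    then obtain y1 i B1 where step: "i \<in> J" "B1 \<subset> B i" "y1 i \<in> convex hull B1"
        "\<forall>j\<in>J. y1 j \<in> convex hull (B j)" "sum y1 J = sum y J"
      using Shapley_Folkman_reduction[OF J less.prems True] by auto
    let ?B = "B(i := B1)"
    have sub: "?B j \<subseteq> B j" for j using step(2) by auto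
    have "(\<Sum>j\<in>J. card (?B j)) < (\<Sum>j\<in>J. card (B j))"
    proof (rule sum_strict_mono_ex1[OF J])
      show "\<forall>j\<in>J. card (?B j) \<le> card (B j)" using sub less.prems(1) by (blast intro: card_mono)
      show "\<exists>j\<in>J. card (?B j) < card (B j)"
        using step less.prems(1) by (intro bexI[of _ i]) (auto intro: psubset_card_mono)
    qed
    moreover have "finite (?B j)" if "j \<in> J" for j
      using sub less.prems(1)[OF that] by (rule finite_subset)
    moreover have "y1 j \<in> convex hull (?B j)" if "j \<in> J" for j
      using step that by simp
    ultimately obtain y' where y': "\<forall>j\<in>J. y' j \<in> convex hull (?B j)" "sum y' J = sum y1 J"
        "card {j\<in>J. y' j \<notin> ?B j} \<le> DIM('a)"
      using less.hyps by blast
    \<comment> \<open>Points of the shrunken sets are points of the original ones, so the bound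
      passes upwards.\<close>
    have "card {j\<in>J. y' j \<notin> B j} \<le> card {j\<in>J. y' j \<notin> ?B j}"
    proof (rule card_mono)
      show "{j\<in>J. y' j \<notin> B j} \<subseteq> {j\<in>J. y' j \<notin> ?B j}" using sub by blast
    qed (use J in simp)
    then have "card {j\<in>J. y' j \<notin> B j} \<le> DIM('a)" using y'(3) by (rule order_trans)
    moreover have "y' j \<in> convex hull (B j)" if "j \<in> J" for j
      using y'(1) that hull_mono[OF sub] by blast
    moreover have "sum y' J = sum y J" using y'(2) step(5) by simp
    ultimately show ?thesis by blast
  qed
qed

section \<open>Rounding in unit cubes\<close>

lemma infnorm_le_vecI:
  fixes x :: "real ^ 'n"
  assumes "\<And>i. \<bar>x $ i\<bar> \<le> c"
  shows "infnorm x \<le> c"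
  unfolding infnorm_cart using assms by (intro cSup_least) auto

lemma infnorm_sum_le:
  fixes f :: "'i \<Rightarrow> 'a::euclidean_space"
  shows "infnorm (sum f F) \<le> (\<Sum>j\<in>F. infnorm (f j))"
proof (induction F rule: infinite_finite_induct)
  case (insert j F)
  then show ?case using infnorm_triangle[of "f j" "sum f F"] by simp
qed (simp_all add: infnorm_0)

text \<open>Reflecting coordinates so that \<open>y\<close> has all its cube coordinates \<open>g i y\<close> at most \<open>1/2\<close>, those
  below \<open>1/n\<close> add up to less than one, so some point of \<open>A\<close> has zeros in all of them.\<close>

lemma unit_cube_hull_infnorm:
  fixes A :: "(real ^ 'n) set"
  assumes n: "2 \<le> CARD('n)" and A: "A \<subseteq> unit_cube b" and y: "y \<in> convex hull A"
  shows "\<exists>a\<in>A. infnorm (y - a) \<le> 1 - 1 / CARD('n)"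
proof -
  define n where "n = real CARD('n)"
  have n2: "2 \<le> n" using n by (simp add: n_def)
  define s where "s i = (if y $ i < b $ i + 1/2 then 1 else - 1 :: real)" for i
  define e where "e i = (if y $ i < b $ i + 1/2 then b $ i else b $ i + 1)" for i
  define g where "g i v = s i * (v $ i - e i)" for i and v :: "real ^ 'n"
  define I where "I = {i. g i y < 1 / n}"
  have cube: "g i a = 0 \<or> g i a = 1" if "a \<in> A" for i a
  proof -
    have "a $ i = b $ i \<or> a $ i = b $ i + 1" using that A by (auto simp: unit_cube_def)
    then show ?thesis by (auto simp: g_def s_def e_def)
  qed
  have half: "g i y \<le> 1/2" for i by (auto simp: g_def s_def e_def)
  \<comment> \<open>The constants \<open>e i\<close> are left out to obtain a linear function and
    return in the next estimate; the minus sign yields an upper bound.\<close>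
  have "linear (\<lambda>v. - (\<Sum>i\<in>I. s i * v $ i))"
    by (rule linearI) (auto simp: algebra_simps sum.distrib sum_distrib_left)
  then obtain a where a: "a \<in> A" "(\<Sum>i\<in>I. s i * a $ i) \<le> (\<Sum>i\<in>I. s i * y $ i)"
    using convex_hull_linear_ge[OF _ y] by fastforce
  have "(\<Sum>i\<in>I. g i a) \<le> (\<Sum>i\<in>I. g i y)"
    using a(2) by (simp add: g_def right_diff_distrib sum_subtractf)
  also have "\<dots> < 1"
  proof (cases "I = {}")
    case False
    then have "(\<Sum>i\<in>I. g i y) < (\<Sum>i\<in>I. 1 / n)"
      by (intro sum_strict_mono) (auto simp: I_def)
    also have "\<dots> = real (card I) / n" by simp
    also have "\<dots> \<le> 1" using n2 card_mono[of UNIV I] by (simp add: n_def field_simps)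
    finally show ?thesis .
  qed simp
  finally have less: "(\<Sum>i\<in>I. g i a) < 1" .
  have zero: "g i a = 0" if "i \<in> I" for i
  proof -
    have "g i a \<le> (\<Sum>i\<in>I. g i a)"
      using that cube[OF a(1)] by (intro member_le_sum) (auto, metis order_refl zero_le_one)
    then show ?thesis using cube[OF a(1), of i] less by auto
  qed
  have "\<bar>y $ i - a $ i\<bar> \<le> 1 - 1 / n" for i
  proof -
    have abs: "\<bar>y $ i - a $ i\<bar> = \<bar>g i y - g i a\<bar>" by (auto simp: g_def s_def)
    \<comment> \<open>From this, \<open>1 / n\<close> and \<open>1/2\<close> are both at most
      \<open>1 - 1 / n\<close>, which covers the coordinates rounded to zero.\<close>
    have nn: "1 / n \<le> 1 / 2" using n2 by (simp add: field_simps)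
    have ge: "0 \<le> g i y"
    proof -
      have "linear (\<lambda>v. - s i * v $ i)" by (rule linearI) (auto simp: algebra_simps)
      then obtain a' where "a' \<in> A" "s i * a' $ i \<le> s i * y $ i"
        using convex_hull_linear_ge[OF _ y] by fastforce
      then show ?thesis using cube[of a' i] by (auto simp: g_def right_diff_distrib)
    qed
    show ?thesis
    proof (cases "i \<in> I")
      case True
      then have "g i a = 0" "g i y < 1 / n" using zero by (auto simp: I_def)
      then show ?thesis using abs ge nn by linarith
    next
      case False
      then have "1 / n \<le> g i y" by (simp add: I_def)
      then show ?thesis using abs cube[OF a(1), of i] half[of i] nn by linarith
    qed
  qed
  then show ?thesis using a(1) by (intro bexI[of _ a] infnorm_le_vecI) (auto simp: n_def)
qed

text \<open>All points of the cube lie on a sphere of radius \<open>sqrt n / 2\<close> around its centre; a vertex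
  in the direction of \<open>s\<close> plus the offset of \<open>y\<close> from the centre compensates the cross terms.\<close>

lemma unit_cube_hull_norm:
  fixes A :: "(real ^ 'n) set"
  assumes A: "A \<subseteq> unit_cube b" and y: "y \<in> convex hull A"
  shows "\<exists>a\<in>A. (norm (s + (y - a)))\<^sup>2 \<le> (norm s)\<^sup>2 + CARD('n) / 4"
proof -
  define c where "c = (\<chi> i. b $ i + 1/2)"
  define u where "u = y - c"
  have "linear (\<lambda>v. (s + u) \<bullet> v)" by (rule linearI) (auto simp: inner_add_right)
  then obtain a where a: "a \<in> A" "(s + u) \<bullet> y \<le> (s + u) \<bullet> a"
    using convex_hull_linear_ge[OF _ y] by blast
  define v where "v = a - c"
  have "v $ i * v $ i = 1/4" for i
  proof -
    have "a $ i = b $ i \<or> a $ i = b $ i + 1" using a(1) A by (auto simp: unit_cube_def)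
    then have "v $ i = - (1/2) \<or> v $ i = 1/2" by (auto simp: v_def c_def)
    then show ?thesis by (elim disjE ssubst) simp_all
  qed
  then have v: "v \<bullet> v = CARD('n) / 4" by (simp only: inner_vec_def inner_real_def) simp
  have su: "(s + u) \<bullet> u \<le> (s + u) \<bullet> v"
    using a(2) by (simp add: u_def v_def inner_diff_right)
  have "(norm (s + (y - a)))\<^sup>2 = (norm (s + u - v))\<^sup>2" by (simp add: u_def v_def)
  \<comment> \<open>Arranged so that the cross term is the difference made nonpositive by the choice
    of \<open>a\<close>.\<close>
  also have "\<dots> = (norm s)\<^sup>2 - u \<bullet> u + 2 * ((s + u) \<bullet> u - (s + u) \<bullet> v) + v \<bullet> v"
    unfolding power2_norm_eq_inner by (simp add: algebra_simps inner_commute)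
  also have "2 * ((s + u) \<bullet> u - (s + u) \<bullet> v) \<le> u \<bullet> u"
    by (rule order_trans[of _ 0]) (use su in simp_all)
  finally have "(norm (s + (y - a)))\<^sup>2 \<le> (norm s)\<^sup>2 + CARD('n) / 4" by (simp add: v)
  then show ?thesis using a(1) by blast
qed

text \<open>In the induction the error accumulated so far plays the role of \<open>s\<close>, so
  squared errors add up as if orthogonal.\<close>

lemma sum_unit_cube_hull_norm:
  fixes A :: "'i \<Rightarrow> (real ^ 'n) set"
  assumes "finite F" and "\<And>j. j \<in> F \<Longrightarrow> A j \<subseteq> unit_cube (b j)"
    and "\<And>j. j \<in> F \<Longrightarrow> y j \<in> convex hull (A j)"
  shows "\<exists>a. (\<forall>j\<in>F. a j \<in> A j) \<and> (norm (\<Sum>j\<in>F. y j - a j))\<^sup>2 \<le> card F * (CARD('n) / 4)"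
  using assms
proof (induction F rule: finite_induct)
  case empty
  then show ?case by simp
next
  case (insert i F)
  then obtain a where a: "\<forall>j\<in>F. a j \<in> A j"
      "(norm (\<Sum>j\<in>F. y j - a j))\<^sup>2 \<le> card F * (CARD('n) / 4)" by auto
  obtain z where z: "z \<in> A i" "(norm ((\<Sum>j\<in>F. y j - a j) + (y i - z)))\<^sup>2
      \<le> (norm (\<Sum>j\<in>F. y j - a j))\<^sup>2 + CARD('n) / 4"
    using unit_cube_hull_norm[of "A i" "b i" "y i"] insert.prems by blast
  have "(\<Sum>j\<in>F. y j - (a(i := z)) j) = (\<Sum>j\<in>F. y j - a j)"
    using insert.hyps by (intro sum.cong) auto
  then have sum_z: "(\<Sum>j\<in>insert i F. y j - (a(i := z)) j) = (\<Sum>j\<in>F. y j - a j) + (y i - z)"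
    using insert.hyps by simp
  have "real (card (insert i F)) * (CARD('n) / 4) = card F * (CARD('n) / 4) + CARD('n) / 4"
    using insert.hyps by (simp add: algebra_simps)
  then have "(norm (\<Sum>j\<in>insert i F. y j - (a(i := z)) j))\<^sup>2 \<le> card (insert i F) * (CARD('n) / 4)"
    unfolding sum_z using a(2) z(2) by linarith
  moreover have "\<forall>j\<in>insert i F. (a(i := z)) j \<in> A j" using a(1) z(1) by simp
  ultimately show ?case by blast
qed

section \<open>Pairing the summands and assembling the bounds\<close>

lemma L_natural_convex_singleton_zero: "L_natural_convex {0}"
  by (simp add: L_natural_convex_def int_lattice_def vec_ceiling_def vec_floor_def vec_eq_iff)

text \<open>For odd \<open>m\<close>, one more summand \<open>{0}\<close> is added.\<close>

lemma sum_L_natural_convex_pairs: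
  fixes S :: "nat \<Rightarrow> (real ^ 'n) set"
  assumes S: "\<And>i. i \<in> {1..m} \<Longrightarrow> L_natural_convex (S i)" and m: "m \<le> 2 * k"
  obtains P Q where "\<And>j. L_natural_convex (P j)" "\<And>j. L_natural_convex (Q j)"
    "(\<Sum>i=1..m. S i) = (\<Sum>j<k. P j + Q j)"
proof
  define S' where "S' i = (if i \<in> {1..m} then S i else {0})" for i
  show "L_natural_convex (S' (2 * j + 1))" "L_natural_convex (S' (2 * j + 2))" for j
    using S L_natural_convex_singleton_zero by (auto simp: S'_def)
  have "(\<Sum>i=1..m. S i) = (\<Sum>i=1..2*k. S' i)"
    using m by (intro sum.mono_neutral_cong_left) (auto simp: S'_def)
  also have "\<dots> = (\<Sum>j<k. S' (2 * j + 1) + S' (2 * j + 2))"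
    by (induction k) (auto simp: add.assoc)
  finally show "(\<Sum>i=1..m. S i) = (\<Sum>j<k. S' (2 * j + 1) + S' (2 * j + 2))" .
qed

text \<open>The hull of a sum is the sum of the hulls. Each part is first localized to the cube at
  its own floor, and only then is Shapley-Folkman applied, so all its points stay in local
  hulls.\<close>

lemma sum_L_natural_convex_local_decomposition:
  fixes P Q :: "nat \<Rightarrow> (real ^ 'n) set"
  assumes P: "\<And>j. L_natural_convex (P j)" and Q: "\<And>j. L_natural_convex (Q j)"
    and x: "x \<in> convex hull (\<Sum>j<k. P j + Q j)"
  obtains y A b where "x = (\<Sum>j<k. y j)" "\<And>j. A j \<subseteq> unit_cube (b j)" "\<And>j. A j \<subseteq> P j + Q j"
    "\<And>j. j < k \<Longrightarrow> y j \<in> convex hull (A j)"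
    "card {j\<in>{..<k}. y j \<notin> A j} \<le> min CARD('n) k"
proof -
  obtain y where y: "x = (\<Sum>j<k. y j)" "\<And>j. j < k \<Longrightarrow> y j \<in> convex hull (P j + Q j)"
    using x unfolding convex_hull_set_sum by (auto simp: set_sum_alt)
  define A where "A j = (P j + Q j) \<inter> unit_cube (vec_floor (y j))" for j
  have "finite (A j)" for j by (simp add: A_def finite_unit_cube)
  moreover have "y j \<in> convex hull (A j)" if "j < k" for j
    unfolding A_def using P Q y(2)[OF that] by (rule L_natural_convex_sum_local_hull)
  ultimately obtain y' where y': "\<forall>j\<in>{..<k}. y' j \<in> convex hull (A j)" "sum y' {..<k} = sum y {..<k}"
      "card {j\<in>{..<k}. y' j \<notin> A j} \<le> DIM(real ^ 'n)"
    using Shapley_Folkman[of "{..<k}" A y] by auto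
  have "card {j\<in>{..<k}. y' j \<notin> A j} \<le> card {..<k}" by (intro card_mono) auto
  then show ?thesis
    using y y' by (intro that[of y' A "\<lambda>j. vec_floor (y j)"]) (auto simp: A_def)
qed

lemma sum_subset_int_lattice:
  fixes S :: "'i \<Rightarrow> (real ^ 'n) set"
  assumes "finite I" and "\<And>i. i \<in> I \<Longrightarrow> S i \<subseteq> int_lattice"
  shows "(\<Sum>i\<in>I. S i) \<subseteq> int_lattice"
proof
  fix x assume "x \<in> (\<Sum>i\<in>I. S i)"
  then obtain s where "x = sum s I" "\<forall>i\<in>I. s i \<in> S i"
    unfolding set_sum_alt[OF assms(1)] by blast
  then show "x \<in> int_lattice"
    using assms(2) by (fastforce simp: int_lattice_def intro: Ints_sum)
qed

lemma infnorm_int_lattice_le_floor: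
  fixes x z :: "real ^ 'n"
  assumes "x \<in> int_lattice" "z \<in> int_lattice" "infnorm (x - z) \<le> c"
  shows "infnorm (x - z) \<le> of_int \<lfloor>c\<rfloor>"
proof (rule infnorm_le_vecI)
  fix i
  have "\<bar>(x - z) $ i\<bar> \<in> \<int>" using assms by (auto simp: int_lattice_def)
  then obtain N where N: "\<bar>(x - z) $ i\<bar> = of_int N" by (auto elim: Ints_cases)
  have "of_int N \<le> c" using component_le_infnorm_cart[of "x - z" i] assms(3) N by simp
  then show "\<bar>(x - z) $ i\<bar> \<le> of_int \<lfloor>c\<rfloor>" unfolding N by (simp add: le_floor_iff)
qed

lemma floor_alpha:
  assumes "1 \<le> n" "1 \<le> k"
  shows "\<lfloor>alpha n k\<rfloor> = int (min n k) - 1"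
proof -
  define l where "l = min n k"
  have l: "1 \<le> l" "l \<le> n" using assms by (auto simp: l_def)
  then have "alpha n k = real l - real l / real n" "0 < real l / real n" "real l / real n \<le> 1"
    by (auto simp: alpha_def l_def algebra_simps)
  then show ?thesis unfolding l_def[symmetric] by linarith
qed

theorem theorem3p6:
  fixes S :: "nat \<Rightarrow> (real ^ 'n) set" and W :: "(real ^ 'n) set" and x :: "real ^ 'n"
    and n m k :: nat
  assumes n_def: "n = CARD('n)" and n_ge: "n \<ge> 2" and m_ge: "m \<ge> 1"
    and L_natural: "\<And>i. i \<in> {1..m} \<Longrightarrow> L_natural_convex (S i)"
    and W_def: "W = (\<Sum>i=1..m. S i)"
    and x_in: "x \<in> convex hull W"
    and k_def: "k = nat \<lceil>real m / 2\<rceil>"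
  shows
    "((\<exists>z\<in>W. infnorm (x - z) \<le> alpha n k) \<and>
      (x \<in> int_lattice \<longrightarrow> (\<exists>z\<in>W. infnorm (x - z) \<le> of_int \<lfloor>alpha n k\<rfloor>)) \<and>
      \<lfloor>alpha n k\<rfloor> = int (min n k) - 1) \<and>
     ((\<exists>z\<in>W. norm (x - z) \<le> beta n k) \<and>
      (x \<in> int_lattice \<longrightarrow> (\<exists>z\<in>W. infnorm (x - z) \<le> of_int \<lfloor>beta n k\<rfloor>))) \<and>
     ((\<exists>z\<in>W. infnorm (x - z) \<le> min (alpha n k) (beta n k)) \<and>
      (x \<in> int_lattice \<longrightarrow>
        (\<exists>z\<in>W. infnorm (x - z) \<le> of_int (min \<lfloor>alpha n k\<rfloor> \<lfloor>beta n k\<rfloor>))))"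
proof -
  have k: "m \<le> 2 * k" "1 \<le> k" using m_ge unfolding k_def by linarith+
  obtain P Q where PQ: "\<And>j. L_natural_convex (P j)" "\<And>j. L_natural_convex (Q j)"
      and "(\<Sum>i=1..m. S i) = (\<Sum>j<k. P j + Q j)"
    by (rule sum_L_natural_convex_pairs[of m S k, OF L_natural k(1)]) (assumption, rule that)
  then have W: "W = (\<Sum>j<k. P j + Q j)" by (simp only: W_def)
  obtain y A b where x: "x = (\<Sum>j<k. y j)" and A: "\<And>j. A j \<subseteq> unit_cube (b j)"
      and A_sub: "\<And>j. A j \<subseteq> P j + Q j" and y: "\<And>j. j < k \<Longrightarrow> y j \<in> convex hull (A j)"
      and card: "card {j\<in>{..<k}. y j \<notin> A j} \<le> min CARD('n) k"
    by (rule sum_L_natural_convex_local_decomposition[OF PQ x_in[unfolded W]]) (rule that)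
  define F where "F = {j\<in>{..<k}. y j \<notin> A j}"
  have F: "finite F" "F \<subseteq> {..<k}" "card F \<le> min n k" using card by (auto simp: F_def n_def)
  \<comment> \<open>Indices outside \<open>F\<close> need no rounding and contribute no error, since
    \<open>y j\<close> is already in \<open>A j\<close>.\<close>
  have round: "\<exists>z\<in>W. x - z = (\<Sum>j\<in>F. y j - a j)" if "\<And>j. j \<in> F \<Longrightarrow> a j \<in> A j" for a
  proof -
    define z where "z j = (if j \<in> F then a j else y j)" for j
    have "z j \<in> P j + Q j" if "j < k" for j
      using that \<open>\<And>j. j \<in> F \<Longrightarrow> a j \<in> A j\<close> A_sub by (auto simp: z_def F_def)
    then have "(\<Sum>j<k. z j) \<in> W" unfolding W set_sum_alt[OF finite_lessThan] by blast
    moreover have "x - (\<Sum>j<k. z j) = (\<Sum>j\<in>F. y j - a j)"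
      unfolding x sum_subtractf[symmetric] using F
      by (intro sum.mono_neutral_cong_right) (auto simp: z_def)
    ultimately show ?thesis by blast
  qed
  have alpha: "\<exists>z\<in>W. infnorm (x - z) \<le> alpha n k"
  proof -
    have "\<exists>a. \<forall>j\<in>F. a j \<in> A j \<and> infnorm (y j - a j) \<le> 1 - 1 / n"
      using unit_cube_hull_infnorm[OF _ A y] n_ge F(2) unfolding n_def by (intro bchoice) blast
    then obtain a where a: "\<And>j. j \<in> F \<Longrightarrow> a j \<in> A j" "\<And>j. j \<in> F \<Longrightarrow> infnorm (y j - a j) \<le> 1 - 1 / n"
      by blast
    have "infnorm (\<Sum>j\<in>F. y j - a j) \<le> (\<Sum>j\<in>F. infnorm (y j - a j))" by (rule infnorm_sum_le)
    also have "\<dots> \<le> (\<Sum>j\<in>F. 1 - 1 / n)" using a(2) by (rule sum_mono)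
    also have "\<dots> = (1 - 1 / n) * card F" by simp
    also have "\<dots> \<le> alpha n k"
      unfolding alpha_def using F(3) n_ge by (intro mult_left_mono) auto
    finally show ?thesis using round[OF a(1)] by metis
  qed
  have beta: "\<exists>z\<in>W. norm (x - z) \<le> beta n k"
  proof -
    obtain a where a: "\<forall>j\<in>F. a j \<in> A j" "(norm (\<Sum>j\<in>F. y j - a j))\<^sup>2 \<le> card F * (n / 4)"
      using sum_unit_cube_hull_norm[OF F(1) A y, of "\<lambda>j. j"] F(2) unfolding n_def by blast
    have "card F * (n / 4) \<le> min n k * (real n / 4)" using F(3) by (intro mult_right_mono) auto
    with a(2) have "norm (\<Sum>j\<in>F. y j - a j) \<le> sqrt (min n k * (real n / 4))"
      by (intro real_le_rsqrt) simp
    also have "\<dots> = beta n k"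
      by (simp add: beta_def real_sqrt_mult real_sqrt_divide mult.commute)
    finally show ?thesis using round[of a] a(1) by metis
  qed
  have inf_beta: "\<exists>z\<in>W. infnorm (x - z) \<le> beta n k"
    using beta infnorm_le_norm order_trans by blast
  have W_int: "W \<subseteq> int_lattice"
    unfolding W_def using L_natural by (intro sum_subset_int_lattice) (auto simp: L_natural_convex_def)
  have floor: "\<exists>z\<in>W. infnorm (x - z) \<le> of_int \<lfloor>c\<rfloor>"
    if "x \<in> int_lattice" "\<exists>z\<in>W. infnorm (x - z) \<le> c" for c
    using that W_int infnorm_int_lattice_le_floor by blast
  have "\<lfloor>alpha n k\<rfloor> = int (min n k) - 1" using floor_alpha n_ge k(2) by simp
  \<comment> \<open>The minimum is one of the two bounds, so the witness for that bound serves in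
    part (3).\<close>
  then show ?thesis
    using alpha beta inf_beta floor[OF _ alpha] floor[OF _ inf_beta] by (auto simp: min_def)
qed

end
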